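(* Let $\mathfrak A$ be a (countable) alphabet. The space $\mathfrak mS[\mathfrak A^*]$ forms a bialgebra with multishuffle product $\star$, cuut coproduct $\blacktriangle$, unit $\eta$ and counit $\varepsilon$.
   Context: $\mathfrak A^*$ is the set of (possibly empty) words in $\mathfrak A$, $\emptyset$ is the empty word, and $\mathfrak mS[\mathfrak A^*]=\prod_{a\in\mathfrak A^*}\mathbb Z a$ is the $\mathbb Z$-module of arbitrary (possibly infinite) $\mathbb Z$-linear combinations of words. A linear map is called continuous if it respects arbitrary (infinite) linear combinations of the words; tensor products are completed accordingly (arbitrary $\mathbb Z$-linear combinations of $a\otimes b$ with $a,b\in\mathfrak A^*$). Multishuffle product. A word $w_1\cdots w_m$ is a multiword of $u=u_1\cdots u_k$ if there is a surjective non-decreasing map $t:[m]\to[k]$ with $w_j=u_{t(j)}$. If $u=u_1\cdots u_k$ and $v=v_1\cdots v_l$ are words with all letters $u_i,v_j$ distinct, a word $w=w_1\cdots w_m$ in the letters $u_i,v_j$ is a multishuffle of $u$ and $v$ if $w_i\ne w_{i+1}$ for all $i$, and the restriction of $w$ to the letters $\{u_i\}$ (respectively $\{v_j\}$) is a multiword of $u$ (respectively $v$). Then $u\star v$ is the sum of all multishuffles of $u$ and $v$. If $x=x_1\cdots x_k$ and $y=y_1\cdots y_l$ are words with possibly repeated letters, $x\star y$ is obtained from $u\star v$ (with $u,v$ of lengths $k,l$ having all letters distinct) by replacing each $u_i$ by $x_i$ and each $v_j$ by $y_j$ (so multiplicities can arise). Extend $\star$ by linearity and continuity. Cuut coproduct.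 For $a=a_1\cdots a_n$, $$\blacktriangle(a)=\sum_{i=0}^n a_1\cdots a_i\otimes a_{i+1}\cdots a_n+\sum_{i=1}^n a_1\cdots a_i\otimes a_ia_{i+1}\cdots a_n,$$ extended by linearity and continuity. Unit: $\eta:\mathbb Z\to\mathfrak mS[\mathfrak A^*]$, $\eta(n)=n\,\emptyset$. Counit: $\varepsilon$ takes the coefficient of $\emptyset$. *)

theory Defs
  imports Main "HOL-Library.Countable" "HOL-Library.Function_Algebras" "HOL-Library.Groups_Big_Fun"
begin

section \<open>Infinite linear combinations and continuous linear maps\<close>

text \<open>
  The \<open>\<int>\<close>-module of arbitrary linear combinations of elements of \<open>'b\<close> is the function type
  \<open>'b \<Rightarrow> int\<close>, a function listing the coefficients.  The completed tensor product of
  \<open>'b \<Rightarrow> int\<close> and \<open>'c \<Rightarrow> int\<close> is \<open>'b \<times> 'c \<Rightarrow> int\<close>, and \<open>\<int>\<close> itself is identified with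
  \<open>unit \<Rightarrow> int\<close> where it has to be a factor of a tensor product.
\<close>

type_synonym 'b comb = "'b \<Rightarrow> int"

definition basis :: "'b \<Rightarrow> 'b comb" where
  "basis b = (\<lambda>x. of_bool (x = b))"

definition tensor :: "'b comb \<Rightarrow> 'c comb \<Rightarrow> ('b \<times> 'c) comb" where
  "tensor f g = (\<lambda>(b, c). f b * g c)"

text \<open>
  \<open>F\<close> sends \<open>\<Sum>b. f b \<cdot> b\<close> to \<open>\<Sum>b. f b \<cdot> F b\<close> for every coefficient family \<open>f\<close>; the second sum makes
  sense for all \<open>f\<close> iff each \<open>c\<close> occurs in only finitely many \<open>F b\<close>.
\<close>

definition continuous_linear :: "('b comb \<Rightarrow> 'c comb) \<Rightarrow> bool" where
  "continuous_linear F \<longleftrightarrow>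
     (\<forall>f g. F (f + g) = F f + F g) \<and>
     (\<forall>c. finite {b. F (basis b) c \<noteq> 0}) \<and>
     (\<forall>f c. F f c = (\<Sum>b. f b * F (basis b) c))"

text \<open>
  Extension by linearity and continuity of a map given on basis elements.  \<^const>\<open>Sum_any\<close> is \<open>0\<close> on
  infinite supports, so the extension is only meaningful if each \<open>c\<close> occurs in finitely many
  \<open>\<phi> b\<close>; since \<open>extend \<phi> (basis b) = \<phi> b\<close> always holds, this is exactly what
  \<open>continuous_linear (extend \<phi>)\<close> guarantees.
\<close>

definition extend :: "('b \<Rightarrow> 'c comb) \<Rightarrow> 'b comb \<Rightarrow> 'c comb" where
  "extend \<phi> f = (\<lambda>c. \<Sum>b. f b * \<phi> b c)"

text \<open>The completed tensor product of two continuous linear maps.\<close>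

definition tensor_map ::
    "('a comb \<Rightarrow> 'c comb) \<Rightarrow> ('b comb \<Rightarrow> 'd comb) \<Rightarrow> ('a \<times> 'b) comb \<Rightarrow> ('c \<times> 'd) comb" where
  "tensor_map F G = extend (\<lambda>(a, b). tensor (F (basis a)) (G (basis b)))"

definition reassoc :: "(('a \<times> 'b) \<times> 'c) comb \<Rightarrow> ('a \<times> ('b \<times> 'c)) comb" where
  "reassoc h = (\<lambda>(a, (b, c)). h ((a, b), c))"

definition swap_middle :: "(('a \<times> 'b) \<times> ('c \<times> 'd)) comb \<Rightarrow> (('a \<times> 'c) \<times> ('b \<times> 'd)) comb" where
  "swap_middle h = (\<lambda>((a, c), (b, d)). h ((a, b), (c, d)))"


section \<open>Bialgebras with respect to the completed tensor product\<close>

locale complete_algebra =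
  fixes mult :: "('b \<times> 'b) comb \<Rightarrow> 'b comb"
    and unit :: "int \<Rightarrow> 'b comb"
  assumes mult_continuous: "continuous_linear mult"
    and unit_continuous: "continuous_linear (\<lambda>n :: unit comb. unit (n ()))"
    and mult_assoc: "mult (tensor_map mult id h) = mult (tensor_map id mult (reassoc h))"
    and mult_unit_left: "mult (tensor (unit n) f) = (\<lambda>b. n * f b)"
    and mult_unit_right: "mult (tensor f (unit n)) = (\<lambda>b. n * f b)"

locale complete_coalgebra =
  fixes comult :: "'b comb \<Rightarrow> ('b \<times> 'b) comb"
    and counit :: "'b comb \<Rightarrow> int"
  assumes comult_continuous: "continuous_linear comult"
    and counit_continuous: "continuous_linear (\<lambda>f (_ :: unit). counit f)"
    and comult_coassoc:
      "reassoc (tensor_map comult id (comult f)) = tensor_map id comult (comult f)"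
    and counit_left: "tensor_map (\<lambda>f (_ :: unit). counit f) id (comult f) ((), b) = f b"
    and counit_right: "tensor_map id (\<lambda>f (_ :: unit). counit f) (comult f) (b, ()) = f b"

locale complete_bialgebra =
  complete_algebra mult unit + complete_coalgebra comult counit
  for mult :: "('b \<times> 'b) comb \<Rightarrow> 'b comb"
    and unit :: "int \<Rightarrow> 'b comb"
    and comult :: "'b comb \<Rightarrow> ('b \<times> 'b) comb"
    and counit :: "'b comb \<Rightarrow> int" +
  assumes comult_mult:
      "comult (mult h) = tensor_map mult mult (swap_middle (tensor_map comult comult h))"
    and comult_unit: "comult (unit 1) = tensor (unit 1) (unit 1)"
    and counit_mult:
      "counit (mult h) =
         tensor_map (\<lambda>f (_ :: unit). counit f) (\<lambda>f (_ :: unit). counit f) h ((), ())"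
    and counit_unit: "counit (unit 1) = 1"


section \<open>Multishuffle product and cuut coproduct\<close>

definition multiword :: "'c list \<Rightarrow> 'c list \<Rightarrow> bool" where
  "multiword w u \<longleftrightarrow>
     (\<exists>t. t ` {..<length w} = {..<length u} \<and> mono_on {..<length w} t \<and>
          (\<forall>j<length w. w ! j = u ! t j))"

text \<open>Intended for words \<open>u\<close> and \<open>v\<close> whose letters are all distinct, i.e.\ \<open>distinct (u @ v)\<close>.\<close>

definition multishuffles :: "'c list \<Rightarrow> 'c list \<Rightarrow> 'c list set" where
  "multishuffles u v =
     {w. set w \<subseteq> set u \<union> set v \<and> distinct_adj w \<and>
         multiword (filter (\<lambda>x. x \<in> set u) w) u \<and>
         multiword (filter (\<lambda>x. x \<in> set v) w) v}"

text \<open>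
  The distinct letters \<open>u\<^sub>i\<close> and \<open>v\<^sub>j\<close> are \<open>Inl i\<close> and \<open>Inr j\<close> (counted from \<open>0\<close>).  The coefficient
  of \<open>z\<close> in the product of \<open>x\<close> and \<open>y\<close> is the number of multishuffles which become \<open>z\<close> on replacing
  \<open>u\<^sub>i\<close> by \<open>x\<^sub>i\<close> and \<open>v\<^sub>j\<close> by \<open>y\<^sub>j\<close>; there are finitely many, as all of them have the length of \<open>z\<close>.
\<close>

definition multishuffle_words :: "'a list \<Rightarrow> 'a list \<Rightarrow> 'a list comb" where
  "multishuffle_words x y =
     (\<lambda>z. int (card {w \<in> multishuffles (map Inl [0..<length x]) (map Inr [0..<length y]).
                     map (case_sum ((!) x) ((!) y)) w = z}))"

definition multishuffle :: "('a list \<times> 'a list) comb \<Rightarrow> 'a list comb" where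
  "multishuffle = extend (\<lambda>(x, y). multishuffle_words x y)"

definition cuut_word :: "'a list \<Rightarrow> ('a list \<times> 'a list) comb" where
  "cuut_word a =
     (\<Sum>i = 0..length a. basis (take i a, drop i a)) +
     (\<Sum>i = 1..length a. basis (take i a, drop (i - 1) a))"

definition cuut :: "'a list comb \<Rightarrow> ('a list \<times> 'a list) comb" where
  "cuut = extend cuut_word"

definition word_unit :: "int \<Rightarrow> 'a list comb" where
  "word_unit n = (\<lambda>w. n * basis [] w)"

definition word_counit :: "'a list comb \<Rightarrow> int" where
  "word_counit f = f []"

end

theory Submission
  imports Defs
begin

text \<open>
  Dually, the cuut coproduct is the product \<open>x * y = xy + [last x = hd y] x (tl y)\<close> on words, for which
  the words are generated by the letters: \<open>a * z = az + [hd z = a] z\<close>.  Sorting the multishuffles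
  with value \<open>az\<close> by the origin of their first letter shows that the dual \<open>\<Delta>\<close> of the multishuffle
  product satisfies \<open>\<Delta>(az) = (a \<otimes> 1 + 1 \<otimes> a - [hd z = a]) * \<Delta>(z)\<close>.  Hence \<open>\<Delta>\<close> is the algebra
  homomorphism for which the letters are primitive, and all axioms follow by induction on words.
\<close>

section \<open>Continuous linear maps\<close>

text \<open>A continuous linear map is the transpose of a map that sends each basis element to a
  finite combination, so every axiom reduces to an equality of coefficients at basis words. The
  obstacle on the dual side is the condition that adjacent letters differ: it concerns the letters
  of \<open>u\<close> and \<open>v\<close>, not their values, so what may follow a first letter
  \<open>e\<close> depends on the origin of the next letter and not just on \<open>z\<close>. For
  one origin the correction is therefore not a coefficient of \<open>\<Delta>(z)\<close>. Added over
  both origins it is, because every multishuffle with a nonempty value \<open>z\<close> begins with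
  the first letter of \<open>u\<close> or of \<open>v\<close>, and that letter has value
  \<open>a\<close> exactly when \<open>hd z = a\<close>. The same term \<open>[hd z = a]\<close>
  separates \<open>a * z\<close> from \<open>az\<close>, so it cancels whenever
  \<open>\<Delta>\<close> is applied to \<open>a * z\<close>; this cancellation recurs in the unit
  law, the compatibility and the associativity.\<close>

lemma basis_apply: "basis b x = of_bool (x = b)"
  by (simp add: basis_def)

lemma Sum_any_basis_mult: "(\<Sum>b. basis b0 b * k b) = (k b0 :: int)"
proof -
  have "(\<Sum>b. basis b0 b * k b) = (\<Sum>b\<in>{b0}. basis b0 b * k b)"
    by (rule Sum_any.expand_superset) (auto simp: basis_def)
  then show ?thesis by (simp add: basis_def)
qed

lemma Sum_any_mult_basis: "(\<Sum>b. f b * of_bool (c = b)) = (f c :: int)"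
proof -
  have "(\<Sum>b. f b * of_bool (c = b)) = (\<Sum>b\<in>{c}. f b * of_bool (c = b))"
    by (rule Sum_any.expand_superset) auto
  then show ?thesis by simp
qed

lemma extend_basis: "extend \<phi> (basis b) = \<phi> b"
  by (simp add: extend_def Sum_any_basis_mult)

lemma continuous_linear_extend:
  fixes \<phi> :: "'b \<Rightarrow> 'c comb"
  assumes "\<And>c. finite {b. \<phi> b c \<noteq> 0}"
  shows "continuous_linear (extend \<phi>)"
proof -
  have fin: "finite {b. f b * \<phi> b c \<noteq> 0}" for f c
    by (rule finite_subset[OF _ assms[of c]]) auto
  have "extend \<phi> (f + g) = extend \<phi> f + extend \<phi> g" for f g
    unfolding extend_def plus_fun_def distrib_right by (intro ext Sum_any.distrib fin)
  then show ?thesis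
    using assms by (auto simp: continuous_linear_def extend_basis) (simp add: extend_def)
qed

lemma continuous_linear_Sum_any:
  "continuous_linear F \<Longrightarrow> F f c = (\<Sum>b. f b * F (basis b) c)"
  unfolding continuous_linear_def by blast

lemma continuous_linear_finite:
  "continuous_linear F \<Longrightarrow> finite {b. F (basis b) c \<noteq> 0}"
  unfolding continuous_linear_def by blast

lemma continuous_linear_eqI:
  assumes "continuous_linear F" "continuous_linear G" "\<And>b. F (basis b) = G (basis b)"
  shows "F f = G f"
proof
  show "F f c = G f c" for c
    unfolding continuous_linear_Sum_any[OF assms(1), of f c]
      continuous_linear_Sum_any[OF assms(2), of f c] assms(3) ..
qed

text \<open>Replaces the infinite sum by one over a finite set independent of \<open>f\<close>, so
  that ordinary sums can be manipulated.\<close>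

lemma continuous_linear_sum:
  assumes "continuous_linear F" "finite B" "\<And>b. F (basis b) c \<noteq> 0 \<Longrightarrow> b \<in> B"
  shows "F f c = (\<Sum>b\<in>B. f b * F (basis b) c)"
proof -
  have "F f c = (\<Sum>b. f b * F (basis b) c)"
    by (rule continuous_linear_Sum_any) fact
  also have "\<dots> = (\<Sum>b\<in>B. f b * F (basis b) c)"
    by (rule Sum_any.expand_superset) (use assms in auto)
  finally show ?thesis .
qed

text \<open>A coefficient of \<open>G (F f)\<close> reads finitely many coefficients of
  \<open>F f\<close>, and each of these reads finitely many coefficients of \<open>f\<close>; over
  the finite sets \<open>B c\<close> and \<open>C c\<close> the two sums can be
  interchanged.\<close>

lemma continuous_linear_compose:
  assumes F: "continuous_linear F" and G: "continuous_linear G"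
  shows "continuous_linear (\<lambda>f. G (F f))"
proof -
  define B where "B c = {b. G (basis b) c \<noteq> 0}" for c
  define C where "C c = (\<Union>b\<in>B c. {a. F (basis a) b \<noteq> 0})" for c
  have finB: "finite (B c)" for c
    unfolding B_def using G by (rule continuous_linear_finite)
  have finC: "finite (C c)" for c
    using F finB by (simp add: C_def continuous_linear_finite)
  have G_sum: "G f c = (\<Sum>b\<in>B c. f b * G (basis b) c)" for f c
    by (rule continuous_linear_sum[OF G finB]) (simp add: B_def)
  have sub: "{a. G (F (basis a)) c \<noteq> 0} \<subseteq> C c" for c
  proof -
    have "G (F (basis a)) c = 0" if "a \<notin> C c" for a
      unfolding G_sum[of "F (basis a)"] by (rule sum.neutral) (use that in \<open>auto simp: C_def\<close>)
    then show ?thesis by blast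
  qed
  have "G (F f) c = (\<Sum>a. f a * G (F (basis a)) c)" for f c
  proof -
    have "G (F f) c = (\<Sum>b\<in>B c. (\<Sum>a\<in>C c. f a * F (basis a) b) * G (basis b) c)"
      unfolding G_sum[of "F f"]
      by (intro sum.cong refl arg_cong2[where f = "(*)"] continuous_linear_sum F finC)
        (auto simp: C_def)
    also have "\<dots> = (\<Sum>a\<in>C c. f a * G (F (basis a)) c)"
      by (subst G_sum[of "F (basis _)"])
        (simp add: sum_distrib_left sum_distrib_right mult.assoc sum.swap[of _ "B c"])
    also have "\<dots> = (\<Sum>a. f a * G (F (basis a)) c)"
      by (rule Sum_any.expand_superset[symmetric]) (use finC sub in auto)
    finally show ?thesis .
  qed
  moreover have "finite {a. G (F (basis a)) c \<noteq> 0}" for c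
    using finC sub by (rule finite_subset[rotated])
  moreover have "G (F (f + g)) = G (F f) + G (F g)" for f g
  proof -
    have "F (f + g) = F f + F g"
      using F unfolding continuous_linear_def by blast
    moreover have "G (F f + F g) = G (F f) + G (F g)"
      using G unfolding continuous_linear_def by blast
    ultimately show ?thesis by simp
  qed
  ultimately show ?thesis
    unfolding continuous_linear_def by blast
qed

text \<open>Each output coefficient reads a single input coefficient, so \<open>\<pi>\<close> may be
  arbitrary. This covers the identity, the rearrangements of tensor factors and the counit at
  once.\<close>

lemma continuous_linear_comp_right: "continuous_linear (\<lambda>h c. h (\<pi> c))"
  unfolding continuous_linear_def
  by (auto simp: basis_def Sum_any_mult_basis plus_fun_def)

lemma continuous_linear_id: "continuous_linear id"
  using continuous_linear_comp_right[of "\<lambda>c. c"] by (simp add: id_def)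

lemma continuous_linear_reassoc: "continuous_linear reassoc"
  using continuous_linear_comp_right[of "\<lambda>(a, b, c). ((a, b), c)"]
  by (simp add: reassoc_def[abs_def] case_prod_unfold)

lemma continuous_linear_swap_middle: "continuous_linear swap_middle"
  using continuous_linear_comp_right[of "\<lambda>((a, c), (b, d)). ((a, b), (c, d))"]
  by (simp add: swap_middle_def[abs_def] case_prod_unfold)

section \<open>Completed tensor products of maps and elements\<close>

lemma continuous_linear_tensor_map:
  assumes F: "continuous_linear F" and G: "continuous_linear G"
  shows "continuous_linear (tensor_map F G)"
  unfolding tensor_map_def
proof (rule continuous_linear_extend)
  fix c
  have "{b. (case b of (a, b) \<Rightarrow> tensor (F (basis a)) (G (basis b))) c \<noteq> 0} \<subseteq>
      {a. F (basis a) (fst c) \<noteq> 0} \<times> {b. G (basis b) (snd c) \<noteq> 0}"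
    by (cases c) (auto simp: tensor_def)
  then show "finite {b. (case b of (a, b) \<Rightarrow> tensor (F (basis a)) (G (basis b))) c \<noteq> 0}"
    by (rule finite_subset) (simp add: F G continuous_linear_finite)
qed

lemma basis_Pair: "basis (a, b) = tensor (basis a) (basis b)"
  by (auto simp: basis_def tensor_def)

lemma tensor_map_basis: "tensor_map F G (basis (a, b)) = tensor (F (basis a)) (G (basis b))"
  by (simp add: tensor_map_def extend_basis)

text \<open>\<open>tensor_map\<close> is prescribed on basis pairs only. Each coefficient of the
  result depends on a finite rectangle of basis pairs, over which the sum factors.\<close>

lemma tensor_map_tensor:
  assumes F: "continuous_linear F" and G: "continuous_linear G"
  shows "tensor_map F G (tensor f g) = tensor (F f) (G g)"
proof (rule ext, clarify)
  fix c d
  let ?A = "{a. F (basis a) c \<noteq> 0}" and ?B = "{b. G (basis b) d \<noteq> 0}"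
  note fin = continuous_linear_finite[OF F] continuous_linear_finite[OF G]
  have "tensor_map F G (tensor f g) (c, d) =
      (\<Sum>p\<in>?A \<times> ?B. tensor f g p * tensor_map F G (basis p) (c, d))"
    by (rule continuous_linear_sum[OF continuous_linear_tensor_map[OF F G]])
      (auto simp: tensor_map_basis tensor_def fin)
  also have "\<dots> = (\<Sum>(a, b)\<in>?A \<times> ?B. (f a * F (basis a) c) * (g b * G (basis b) d))"
    by (rule sum.cong) (auto simp: tensor_map_basis tensor_def)
  also have "\<dots> = F f c * G g d"
    unfolding sum.cartesian_product[symmetric] sum_product[symmetric]
    by (intro arg_cong2[where f = "(*)"] continuous_linear_sum[symmetric] F G fin) auto
  finally show "tensor_map F G (tensor f g) (c, d) = tensor (F f) (G g) (c, d)"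
    by (simp add: tensor_def)
qed

lemma continuous_linear_tensor_left:
  fixes g :: "'c comb"
  shows "continuous_linear (\<lambda>f :: 'b comb. tensor f g)"
proof -
  \<comment> \<open>\<open>?G\<close> sends the generator of the rank-one module to
    \<open>g\<close>, so \<open>tensor f g\<close> is the image under
    \<open>tensor_map id ?G\<close> of \<open>f\<close> tensored with that generator.\<close>
  let ?G = "extend (\<lambda>_ :: unit. g)"
  have G: "continuous_linear ?G"
    by (rule continuous_linear_extend) simp
  have "(\<lambda>f :: 'b comb. tensor f g) = (\<lambda>f. tensor_map id ?G (\<lambda>c. f (fst c)))"
  proof
    fix f :: "'b comb"
    have "(\<lambda>c. f (fst c)) = tensor f (basis ())"
      by (auto simp: tensor_def basis_def)
    then show "tensor f g = tensor_map id ?G (\<lambda>c. f (fst c))"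
      by (simp only: tensor_map_tensor[OF continuous_linear_id G] extend_basis id_apply)
  qed
  then show ?thesis
    by (simp only:) (rule continuous_linear_compose[OF continuous_linear_comp_right
          continuous_linear_tensor_map[OF continuous_linear_id G]])
qed

lemma continuous_linear_tensor_right:
  fixes f :: "'b comb"
  shows "continuous_linear (\<lambda>g :: 'c comb. tensor f g)"
proof -
  have "(\<lambda>g :: 'c comb. tensor f g) = (\<lambda>g c. tensor g f (prod.swap c))"
    by (auto simp: tensor_def fun_eq_iff)
  then show ?thesis
    by (simp only:) (rule continuous_linear_compose[OF continuous_linear_tensor_left
          continuous_linear_comp_right])
qed

lemma reassoc_tensor: "reassoc (tensor (tensor f g) h) = tensor f (tensor g h)"
  by (auto simp: reassoc_def tensor_def fun_eq_iff mult.assoc)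

lemma swap_middle_basis: "swap_middle (basis ((a, b), (c, d))) = basis ((a, c), (b, d))"
  by (auto simp: swap_middle_def basis_def fun_eq_iff)

section \<open>A recursion for the multishuffle coefficients\<close>

text \<open>
  Functions of words are regarded as linear combinations here, and \<open>cons_mult a f\<close> is the product
  \<open>a * f\<close> dual to the cuut coproduct.
\<close>

primrec cons_mult :: "'a \<Rightarrow> ('a list \<Rightarrow> int) \<Rightarrow> 'a list \<Rightarrow> int" where
  "cons_mult a f [] = 0"
| "cons_mult a f (b # x) = (if b = a then f x + f (b # x) else 0)"

text \<open>The coefficient of \<open>x \<otimes> y\<close> in \<open>\<Delta>(z)\<close>. The guard
  \<open>z \<noteq> []\<close> is there because \<open>hd []\<close> is unspecified.\<close>

primrec shuffle_coeff :: "'a list \<Rightarrow> 'a list \<Rightarrow> 'a list \<Rightarrow> int" where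
  "shuffle_coeff [] x y = of_bool (x = [] \<and> y = [])"
| "shuffle_coeff (a # z) x y =
     cons_mult a (\<lambda>x. shuffle_coeff z x y) x + cons_mult a (\<lambda>y. shuffle_coeff z x y) y -
     (if z \<noteq> [] \<and> hd z = a then shuffle_coeff z x y else 0)"

section \<open>Multiwords and multishuffles by their first letter\<close>

lemma multiword_Nil_left: "multiword [] u \<longleftrightarrow> u = []"
  by (auto simp: multiword_def)

text \<open>Surjectivity and monotonicity force \<open>t 0 = 0\<close>. The positions after the
  first either still attain the value 0, or they do not, and then all values can be lowered by
  one.\<close>

lemma multiword_Cons_Cons:
  "multiword (e # s) (e # u) \<longleftrightarrow> multiword s (e # u) \<or> multiword s u"
proof
  assume "multiword (e # s) (e # u)"
  then obtain t where img: "t ` {..<Suc (length s)} = {..<Suc (length u)}"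
    and mono: "mono_on {..<Suc (length s)} t"
    and nth: "\<And>j. j < Suc (length s) \<Longrightarrow> (e # s) ! j = (e # u) ! t j"
    unfolding multiword_def by auto
  obtain i where "i < Suc (length s)" "t i = 0"
    using img by (metis imageE lessThan_iff zero_less_Suc)
  then have t0: "t 0 = 0"
    using mono by (metis bot_nat_0.extremum le_zero_eq lessThan_iff mono_onD zero_less_Suc)
  have "insert 0 ((\<lambda>j. t (Suc j)) ` {..<length s}) = t ` {..<Suc (length s)}"
    by (simp add: lessThan_Suc_eq_insert_0 t0 image_image)
  then have img': "{..<Suc (length u)} = insert 0 ((\<lambda>j. t (Suc j)) ` {..<length s})"
    using img by simp
  have mono': "t (Suc i) \<le> t (Suc j)" if "i \<le> j" "j < length s" for i j
    using mono that by (auto simp: mono_on_def)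
  show "multiword s (e # u) \<or> multiword s u"
  proof (cases "0 \<in> (\<lambda>j. t (Suc j)) ` {..<length s}")
    case True
    then have "(\<lambda>j. t (Suc j)) ` {..<length s} = {..<length (e # u)}"
      using img' by auto
    moreover have "\<forall>j<length s. s ! j = (e # u) ! t (Suc j)"
      using nth by force
    ultimately have "multiword s (e # u)"
      unfolding multiword_def using mono' by (intro exI[of _ "\<lambda>j. t (Suc j)"]) (auto simp: mono_on_def)
    then show ?thesis ..
  next
    case False
    then have pos: "t (Suc j) > 0" if "j < length s" for j
      using that by (metis gr0I imageI lessThan_iff)
    have "(\<lambda>j. t (Suc j)) ` {..<length s} = {..<Suc (length u)} - {0}"
      using img' False by auto
    then have "(\<lambda>k. k - 1) ` (\<lambda>j. t (Suc j)) ` {..<length s} = (\<lambda>k. k - 1) ` Suc ` {..<length u}"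
      by (auto simp: lessThan_Suc_eq_insert_0)
    then have "(\<lambda>j. t (Suc j) - 1) ` {..<length s} = {..<length u}"
      by (simp add: image_image)
    moreover have "\<forall>j<length s. s ! j = u ! (t (Suc j) - 1)"
      using nth pos by (metis Suc_mono nth_Cons_Suc nth_Cons_pos)
    ultimately have "multiword s u"
      unfolding multiword_def using mono'
      by (intro exI[of _ "\<lambda>j. t (Suc j) - 1"]) (auto simp: mono_on_def intro!: diff_le_mono)
    then show ?thesis ..
  qed
next
  assume "multiword s (e # u) \<or> multiword s u"
  then show "multiword (e # s) (e # u)"
  proof
    assume "multiword s (e # u)"
    then obtain t where img: "t ` {..<length s} = {..<Suc (length u)}"
      and mono: "mono_on {..<length s} t" and nth: "\<And>j. j < length s \<Longrightarrow> s ! j = (e # u) ! t j"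
      unfolding multiword_def by auto
    let ?t = "case_nat 0 t"
    have "?t ` {..<Suc (length s)} = insert 0 (t ` {..<length s})"
      by (simp add: lessThan_Suc_eq_insert_0 image_image)
    then have "?t ` {..<Suc (length s)} = {..<Suc (length u)}"
      unfolding img by auto
    moreover have "mono_on {..<Suc (length s)} ?t"
      using mono by (auto simp: mono_on_def split: nat.split)
    moreover have "\<forall>j<Suc (length s). (e # s) ! j = (e # u) ! ?t j"
      using nth by (auto simp: nth_Cons split: nat.split)
    ultimately show ?thesis
      unfolding multiword_def by (intro exI[of _ ?t]) simp
  next
    assume "multiword s u"
    then obtain t where img: "t ` {..<length s} = {..<length u}"
      and mono: "mono_on {..<length s} t" and nth: "\<And>j. j < length s \<Longrightarrow> s ! j = u ! t j"
      unfolding multiword_def by auto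
    let ?t = "case_nat 0 (\<lambda>j. Suc (t j))"
    have "?t ` {..<Suc (length s)} = insert 0 (Suc ` t ` {..<length s})"
      by (simp add: lessThan_Suc_eq_insert_0 image_image)
    then have "?t ` {..<Suc (length s)} = {..<Suc (length u)}"
      unfolding img by (simp add: lessThan_Suc_eq_insert_0)
    moreover have "mono_on {..<Suc (length s)} ?t"
      using mono by (auto simp: mono_on_def split: nat.split)
    moreover have "\<forall>j<Suc (length s). (e # s) ! j = (e # u) ! ?t j"
      using nth by (auto simp: nth_Cons split: nat.split)
    ultimately show ?thesis
      unfolding multiword_def by (intro exI[of _ ?t]) simp
  qed
qed

lemma multiword_set: "multiword w u \<Longrightarrow> set w = set u"
proof -
  assume "multiword w u"
  then obtain t where "t ` {..<length w} = {..<length u}" "\<And>j. j < length w \<Longrightarrow> w ! j = u ! t j"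
    unfolding multiword_def by auto
  then have "(!) w ` {..<length w} = (!) u ` {..<length u}"
    by (metis (no_types, lifting) image_cong image_image lessThan_iff)
  then show ?thesis
    by (metis atLeast_upt list.set_map map_nth)
qed

lemma multiword_Cons_left:
  "multiword (e # s) u \<longleftrightarrow> (\<exists>u'. u = e # u' \<and> (multiword s u \<or> multiword s u'))"
proof
  assume m: "multiword (e # s) u"
  then obtain t where img: "t ` {..<Suc (length s)} = {..<length u}"
    and mono: "mono_on {..<Suc (length s)} t" and nth: "(e # s) ! 0 = u ! t 0"
    unfolding multiword_def by auto
  have "length u > 0"
    using img by force
  then obtain i where "i < Suc (length s)" "t i = 0"
    using img by (metis imageE lessThan_iff)
  then have "t 0 = 0"
    using mono by (metis bot_nat_0.extremum le_zero_eq lessThan_iff mono_onD zero_less_Suc)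
  then obtain u' where "u = e # u'"
    using nth \<open>length u > 0\<close> by (cases u) auto
  then show "\<exists>u'. u = e # u' \<and> (multiword s u \<or> multiword s u')"
    using m by (auto simp: multiword_Cons_Cons)
qed (auto simp: multiword_Cons_Cons)

lemma multishuffles_commute: "multishuffles u v = multishuffles v u"
  by (auto simp: multishuffles_def)

text \<open>After the leading \<open>e\<close>, either the block of \<open>e\<close> in the
  restriction to \<open>e # u\<close> continues, or it is finished and \<open>w\<close> is a
  multishuffle of \<open>u\<close> and \<open>v\<close>.\<close>

lemma multishuffles_Cons_left:
  assumes "distinct (e # u @ v)"
  shows "e # w \<in> multishuffles (e # u) v \<longleftrightarrow>
    distinct_adj (e # w) \<and> (w \<in> multishuffles (e # u) v \<or> w \<in> multishuffles u v)"
proof -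
  have e: "e \<notin> set u" "e \<notin> set v" using assms by auto
  \<comment> \<open>Restricting to the letters of \<open>e # u\<close> has to agree with restricting
    to those of \<open>u\<close>. For the converse, a multiword of \<open>u\<close> contains no
    \<open>e\<close>, which keeps \<open>e\<close> out of \<open>w\<close>.\<close>
  have "w \<in> multishuffles u v \<longleftrightarrow> set w \<subseteq> set (e # u) \<union> set v \<and> distinct_adj w \<and>
      multiword (filter (\<lambda>x. x \<in> set (e # u)) w) u \<and> multiword (filter (\<lambda>x. x \<in> set v) w) v"
    (is "?l \<longleftrightarrow> ?r")
  proof
    assume ?l
    moreover from this have "filter (\<lambda>x. x \<in> set (e # u)) w = filter (\<lambda>x. x \<in> set u) w"
      using e by (intro filter_cong) (auto simp: multishuffles_def)
    ultimately show ?r by (auto simp: multishuffles_def)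
  next
    assume r: ?r
    then have "e \<notin> set w"
      using multiword_set[of "filter (\<lambda>x. x \<in> set (e # u)) w" u] e by auto
    moreover from this have "filter (\<lambda>x. x \<in> set (e # u)) w = filter (\<lambda>x. x \<in> set u) w"
      by (intro filter_cong) auto
    ultimately show ?l using r by (auto simp: multishuffles_def)
  qed
  moreover have "distinct_adj (e # w) \<Longrightarrow> distinct_adj w"
    by (cases w) auto
  ultimately show ?thesis
    using e by (auto simp: multishuffles_def multiword_Cons_Cons)
qed

lemma multishuffles_hd:
  assumes "e # w \<in> multishuffles u v"
  shows "(\<exists>u'. u = e # u') \<or> (\<exists>v'. v = e # v')"
  using assms by (auto simp: multishuffles_def multiword_Cons_left split: if_splits)

lemma Nil_in_multishuffles: "[] \<in> multishuffles u v \<longleftrightarrow> u = [] \<and> v = []"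
  by (auto simp: multishuffles_def multiword_Nil_left)

text \<open>
  Labelling arbitrary distinct letters, rather than the indices \<open>Inl i\<close> and \<open>Inr j\<close>, avoids
  shifting indices when the first letter of a word is removed.
\<close>

definition labelled :: "('c \<Rightarrow> 'a) \<Rightarrow> 'a list \<Rightarrow> 'c list \<Rightarrow> 'c list \<Rightarrow> 'c list set" where
  "labelled l z u v = {w \<in> multishuffles u v. map l w = z}"

lemma labelled_commute: "labelled l z u v = labelled l z v u"
  by (simp add: labelled_def multishuffles_commute)

lemma finite_labelled: "finite (labelled l z u v)"
  by (rule finite_subset[OF _ finite_lists_length_eq[of "set u \<union> set v" "length z"]])
    (auto simp: labelled_def multishuffles_def)

text \<open>Deleting the leading \<open>e\<close> leaves a word in which \<open>e\<close> no longer
  occurs (a multishuffle of \<open>u\<close> and \<open>v\<close>) or one in which it does (a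
  multishuffle of \<open>e # u\<close> and \<open>v\<close>). Of the latter, those starting with
  \<open>e\<close> are excluded because adjacent letters differ.\<close>

lemma card_labelled_Cons_hd:
  assumes "distinct (e # u @ v)"
  shows "int (card {w \<in> labelled l (a # z) (e # u) v. hd w = e}) =
    (if l e = a then int (card (labelled l z u v)) + int (card (labelled l z (e # u) v)) -
       int (card {w \<in> labelled l z (e # u) v. hd w = e}) else 0)"
proof (cases "l e = a")
  case True
  let ?A = "labelled l z u v" and ?B = "labelled l z (e # u) v"
  let ?C = "{w \<in> ?B. hd w = e}"
  have e: "e \<notin> set w" if "w \<in> ?A" for w
    using that assms by (auto simp: labelled_def multishuffles_def)
  have e': "e \<in> set w" if "w \<in> ?B" for w
    using that multiword_set[of "filter (\<lambda>x. x \<in> set (e # u)) w" "e # u"]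
    by (auto simp: labelled_def multishuffles_def)
  have "{w \<in> labelled l (a # z) (e # u) v. hd w = e} = (#) e ` (?A \<union> (?B - ?C))"
  proof (intro equalityI subsetI)
    fix w assume "w \<in> {w \<in> labelled l (a # z) (e # u) v. hd w = e}"
    then obtain w' where w: "w = e # w'" "map l w' = z" "e # w' \<in> multishuffles (e # u) v"
      by (cases w) (auto simp: labelled_def)
    then show "w \<in> (#) e ` (?A \<union> (?B - ?C))"
      using e' by (cases w') (auto simp: multishuffles_Cons_left[OF assms] labelled_def)
  next
    fix w assume "w \<in> (#) e ` (?A \<union> (?B - ?C))"
    then obtain w' where w: "w = e # w'" "w' \<in> ?A \<or> w' \<in> ?B \<and> hd w' \<noteq> e"
      by auto
    have "distinct_adj (e # w')"
      using w e[of w'] by (cases w') (auto simp: labelled_def multishuffles_def)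
    then show "w \<in> {w \<in> labelled l (a # z) (e # u) v. hd w = e}"
      using w True by (auto simp: multishuffles_Cons_left[OF assms] labelled_def)
  qed
  then have "card {w \<in> labelled l (a # z) (e # u) v. hd w = e} = card (?A \<union> (?B - ?C))"
    by (simp add: card_image)
  also have "\<dots> = card ?A + card (?B - ?C)"
    using e e' by (intro card_Un_disjoint) (auto simp: finite_labelled)
  also have "card (?B - ?C) = card ?B - card ?C"
    by (intro card_Diff_subset) (auto simp: finite_labelled)
  finally have "card {w \<in> labelled l (a # z) (e # u) v. hd w = e} = card ?A + (card ?B - card ?C)" .
  moreover have "card ?C \<le> card ?B"
    by (intro card_mono) (auto simp: finite_labelled)
  ultimately show ?thesis using True by simp
next
  case False
  then have empty: "{w \<in> labelled l (a # z) (e # u) v. hd w = e} = {}"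
    by (auto simp: labelled_def)
  show ?thesis unfolding empty using False by simp
qed

text \<open>The witness \<open>u'\<close> makes the set empty for \<open>u = []\<close>, where
  \<open>hd u\<close> is unspecified. Swapping \<open>u\<close> and \<open>v\<close> gives the
  multishuffles of the other origin.\<close>

definition labelled_hd :: "('c \<Rightarrow> 'a) \<Rightarrow> 'a list \<Rightarrow> 'c list \<Rightarrow> 'c list \<Rightarrow> 'c list set" where
  "labelled_hd l z u v = {w \<in> labelled l z u v. \<exists>w' u'. w = hd u # w' \<and> u = hd u # u'}"

lemma finite_labelled_hd: "finite (labelled_hd l z u v)"
  by (simp add: labelled_hd_def finite_labelled)

lemma card_labelled_split:
  assumes "distinct (u @ v)" "z \<noteq> []"
  shows "card (labelled l z u v) = card (labelled_hd l z u v) + card (labelled_hd l z v u)"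
proof -
  have "labelled l z u v = labelled_hd l z u v \<union> labelled_hd l z v u"
  proof (intro equalityI subsetI)
    fix w assume w: "w \<in> labelled l z u v"
    then obtain e w' where "w = e # w'"
      using assms by (cases w) (auto simp: labelled_def)
    then show "w \<in> labelled_hd l z u v \<union> labelled_hd l z v u"
      using w multishuffles_hd[of e w' u v]
      by (auto simp: labelled_hd_def labelled_def multishuffles_commute)
  qed (auto simp: labelled_hd_def labelled_commute)
  moreover have "labelled_hd l z u v \<inter> labelled_hd l z v u = {}"
    using assms by (cases u; cases v) (auto simp: labelled_hd_def)
  ultimately show ?thesis
    by (simp add: card_Un_disjoint finite_labelled_hd)
qed

text \<open>The correction is conditioned on \<open>hd z = a\<close> instead of
  \<open>l e = a\<close>, so that the corrections for \<open>u\<close> and for \<open>v\<close> can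
  be added. The count is the same, since a word with value \<open>z\<close> can start with
  \<open>e\<close> only if \<open>hd z = l e\<close>.\<close>

lemma card_labelled_hd_Cons:
  assumes "distinct (u @ v)"
  shows "int (card (labelled_hd l (a # z) u v)) =
    (case u of [] \<Rightarrow> 0 | e # u' \<Rightarrow> if l e = a
       then int (card (labelled l z u' v)) + int (card (labelled l z u v)) else 0) -
    (if z \<noteq> [] \<and> hd z = a then int (card (labelled_hd l z u v)) else 0)"
proof (cases u)
  case Nil
  then show ?thesis by (simp add: labelled_hd_def)
next
  case (Cons e u')
  have eq: "labelled_hd l z u v = {w \<in> labelled l z u v. hd w = e}" for z
  proof -
    have "w \<noteq> []" if "w \<in> labelled l z u v" for w
      using that by (auto simp: labelled_def Cons Nil_in_multishuffles)
    then have "w \<in> labelled l z u v \<Longrightarrow> (\<exists>w'. w = e # w') \<longleftrightarrow> hd w = e" for w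
      by (cases w) auto
    then show ?thesis
      by (auto simp: labelled_hd_def Cons)
  qed
  have 1: "card {w \<in> labelled l z u v. hd w = e} = 0" if "\<not> (z \<noteq> [] \<and> hd z = l e)"
  proof -
    have "z \<noteq> [] \<and> hd z = l (hd w)" if "w \<in> labelled l z u v" for w
      using that by (cases w) (auto simp: labelled_def Cons Nil_in_multishuffles)
    then have empty: "{w \<in> labelled l z u v. hd w = e} = {}"
      using that by auto
    show ?thesis unfolding empty by simp
  qed
  show ?thesis
    using card_labelled_Cons_hd[of e u' v l a z] assms 1
    unfolding eq by (auto simp: Cons)
qed

lemma card_labelled:
  assumes "distinct (u @ v)"
  shows "int (card (labelled l z u v)) = shuffle_coeff z (map l u) (map l v)"
  using assms
proof (induction z arbitrary: u v)
  case Nil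
  have "labelled l [] u v = (if u = [] \<and> v = [] then {[]} else {})"
    by (auto simp: labelled_def Nil_in_multishuffles)
  then show ?case by simp
next
  case (Cons a z)
  have d: "distinct (v @ u)" using Cons.prems by auto
  have 1: "(case u of [] \<Rightarrow> 0 | e # u' \<Rightarrow> if l e = a
       then int (card (labelled l z u' v)) + int (card (labelled l z u v)) else 0) =
     cons_mult a (\<lambda>x. shuffle_coeff z x (map l v)) (map l u)"
    using Cons.prems Cons.IH[of "tl u" v] Cons.IH[of u v] by (cases u) simp_all
  have 2: "(case v of [] \<Rightarrow> 0 | e # v' \<Rightarrow> if l e = a
       then int (card (labelled l z v' u)) + int (card (labelled l z v u)) else 0) =
     cons_mult a (\<lambda>y. shuffle_coeff z (map l u) y) (map l v)"
    using Cons.prems Cons.IH[of u "tl v"] Cons.IH[of u v]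
    by (cases v) (simp_all add: labelled_commute[of l z _ u])
  \<comment> \<open>The splitting by origin is used twice: at \<open>a # z\<close> to separate the
    two origins, and at a nonempty \<open>z\<close> to merge the two corrections into the full count
    for \<open>z\<close>.\<close>
  have "int (card (labelled l (a # z) u v)) =
      cons_mult a (\<lambda>x. shuffle_coeff z x (map l v)) (map l u) +
      cons_mult a (\<lambda>y. shuffle_coeff z (map l u) y) (map l v) -
      (if z \<noteq> [] \<and> hd z = a then int (card (labelled l z u v)) else 0)"
    using card_labelled_hd_Cons[OF Cons.prems, of l a z] card_labelled_hd_Cons[OF d, of l a z]
      card_labelled_split[OF Cons.prems, of z l]
      card_labelled_split[OF Cons.prems, of "a # z" l]
    unfolding 1 2 by (cases "z \<noteq> [] \<and> hd z = a") auto
  then show ?case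
    using Cons.IH[OF Cons.prems] by simp
qed

lemma multishuffle_words_eq: "multishuffle_words x y z = shuffle_coeff z x y"
proof -
  let ?u = "map Inl [0..<length x] :: (nat + nat) list" and ?v = "map Inr [0..<length y]"
  have "map (case_sum ((!) x) ((!) y)) ?u = x" "map (case_sum ((!) x) ((!) y)) ?v = y"
    by (simp_all add: comp_def map_nth)
  moreover have "distinct (?u @ ?v)"
    by (auto simp: distinct_map)
  ultimately show ?thesis
    using card_labelled[of ?u ?v "case_sum ((!) x) ((!) y)" z]
    by (simp add: multishuffle_words_def labelled_def)
qed

section \<open>Pairing with the cuut coproduct\<close>

text \<open>The functional with values \<open>h p q\<close> applied to the coproduct of a word; as a
  function of that word, the combination of the products \<open>p * q\<close> with coefficients
  \<open>h p q\<close>. The recursion follows the place of the cut: before \<open>a\<close>, through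
  \<open>a\<close>, or later. As \<open>h\<close> is a parameter, inductions can absorb
  \<open>a\<close> into it.\<close>

primrec cuut_pair :: "('a list \<Rightarrow> 'a list \<Rightarrow> int) \<Rightarrow> 'a list \<Rightarrow> int" where
  "cuut_pair h [] = h [] []"
| "cuut_pair h (a # x) = h [] (a # x) + h [a] (a # x) + cuut_pair (\<lambda>p q. h (a # p) q) x"

lemma cuut_pair_add: "cuut_pair (\<lambda>p q. h p q + k p q) x = cuut_pair h x + cuut_pair k x"
  by (induction x arbitrary: h k) auto

lemma cuut_pair_diff: "cuut_pair (\<lambda>p q. h p q - k p q) x = cuut_pair h x - cuut_pair k x"
  by (induction x arbitrary: h k) auto

lemma cuut_pair_mult: "cuut_pair (\<lambda>p q. n * h p q) x = n * cuut_pair h x"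
  by (induction x arbitrary: h) (auto simp: distrib_left)

lemma cuut_pair_zero: "cuut_pair (\<lambda>p q. 0) x = 0"
  by (induction x) auto

text \<open>Dually this is \<open>(a * p) * q = a * (p * q)\<close> for a letter
  \<open>a\<close>.\<close>

lemma cuut_pair_cons_mult:
  "cuut_pair (\<lambda>p q. cons_mult a (\<lambda>p. h p q) p) x = cons_mult a (cuut_pair h) x"
  by (cases x) (auto simp: cuut_pair_add cuut_pair_zero)

lemma cuut_pair_cons_mult_param:
  "cuut_pair (\<lambda>p q. cons_mult a (h p q) z) x = cons_mult a (\<lambda>z. cuut_pair (\<lambda>p q. h p q z) x) z"
  by (cases z) (auto simp: cuut_pair_add cuut_pair_zero)

text \<open>Triples whose first cut is before or through \<open>a\<close> match after unfolding; the
  others are the induction hypothesis with \<open>a\<close> absorbed into \<open>h\<close>.\<close>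

lemma cuut_pair_assoc:
  "cuut_pair (\<lambda>w r. cuut_pair (\<lambda>p q. h p q r) w) x =
   cuut_pair (\<lambda>p w. cuut_pair (\<lambda>q r. h p q r) w) x"
proof (induction x arbitrary: h)
  case (Cons a x)
  show ?case
    using Cons.IH[of "\<lambda>p. h (a # p)"] by (simp add: cuut_pair_add)
qed simp

lemma cuut_pair_counit_left: "cuut_pair (\<lambda>p q. of_bool (p = []) * h q) x = h x"
  by (cases x) (auto simp: cuut_pair_zero)

lemma cuut_pair_counit_right: "cuut_pair (\<lambda>p q. h p * of_bool (q = [])) x = h x"
  by (induction x arbitrary: h) auto

lemma cuut_pair_eq_sum:
  "cuut_pair h x = (\<Sum>i = 0..length x. h (take i x) (drop i x)) +
     (\<Sum>i = 1..length x. h (take i x) (drop (i - 1) x))"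
proof (induction x arbitrary: h)
  case (Cons a x)
  have "(\<Sum>i = 0..length (a # x). h (take i (a # x)) (drop i (a # x))) =
      h [] (a # x) + (\<Sum>i = 0..length x. h (a # take i x) (drop i x))"
    by (simp add: sum.atLeast0_atMost_Suc_shift del: sum.atLeast0_atMost_Suc sum.cl_ivl_Suc)
  moreover have "(\<Sum>i = 1..length (a # x). h (take i (a # x)) (drop (i - 1) (a # x))) =
      (\<Sum>i = 0..length x. h (a # take i x) (drop i (a # x)))"
    by (simp add: sum.atLeast_Suc_atMost_Suc_shift del: sum.cl_ivl_Suc)
  \<comment> \<open>Only \<open>i = 0\<close> is special and gives the cut through \<open>a\<close>;
    for larger \<open>i\<close>, dropping \<open>i\<close> letters of \<open>a # x\<close> drops
    \<open>i - 1\<close> letters of \<open>x\<close>.\<close>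
  moreover have "(\<Sum>i = 0..length x. h (a # take i x) (drop i (a # x))) =
      h [a] (a # x) + (\<Sum>i = 1..length x. h (a # take i x) (drop (i - 1) x))"
    by (simp add: sum.atLeast_Suc_atMost drop_Cons')
  ultimately show ?case
    by (simp add: Cons.IH)
qed simp

section \<open>From the pairing to the coefficients of \<open>cuut_word\<close>\<close>

lemma sum_fun_apply: "(\<Sum>i\<in>I. f i) x = (\<Sum>i\<in>I. f i x)" for f :: "'i \<Rightarrow> 'b comb"
  by (induction I rule: infinite_finite_induct) auto

lemma Sum_any_basis_sum:
  fixes k :: "'b \<Rightarrow> int"
  assumes "finite I" "finite J"
  shows "(\<Sum>b. ((\<Sum>i\<in>I. basis (f i)) + (\<Sum>j\<in>J. basis (g j))) b * k b) =
    (\<Sum>i\<in>I. k (f i)) + (\<Sum>j\<in>J. k (g j))" (is "(\<Sum>b. ?F b * k b) = _")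
proof -
  let ?B = "f ` I \<union> g ` J"
  have "(\<Sum>b. ?F b * k b) = (\<Sum>b\<in>?B. ?F b * k b)"
  proof (rule Sum_any.expand_superset)
    have "(\<Sum>i\<in>I. basis (f i)) b = 0" "(\<Sum>j\<in>J. basis (g j)) b = 0" if "b \<notin> ?B" for b
      using that unfolding sum_fun_apply by (auto simp: basis_def intro!: sum.neutral simp del: sum_of_bool_eq)
    then have "?F b * k b = 0" if "b \<notin> ?B" for b
      using that by simp
    then show "{b. ?F b * k b \<noteq> 0} \<subseteq> ?B"
      by blast
  qed (use assms in simp)
  also have "\<dots> = (\<Sum>i\<in>I. \<Sum>b\<in>?B. basis (f i) b * k b) + (\<Sum>j\<in>J. \<Sum>b\<in>?B. basis (g j) b * k b)"
    unfolding plus_fun_apply sum_fun_apply distrib_right sum.distrib sum_distrib_right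
    by (intro arg_cong2[where f = "(+)"] sum.swap)
  also have "\<dots> = (\<Sum>i\<in>I. k (f i)) + (\<Sum>j\<in>J. k (g j))"
  proof -
    have "(\<Sum>b\<in>?B. basis c b * k b) = k c" if "c \<in> ?B" for c
    proof -
      have "basis c b * k b = (if b = c then k b else 0)" for b
        by (simp add: basis_def)
      then show ?thesis using that assms by simp
    qed
    then show ?thesis by simp
  qed
  finally show ?thesis .
qed

lemma Sum_any_cuut_word: "(\<Sum>b. cuut_word x b * k b) = cuut_pair (\<lambda>p q. k (p, q)) x"
  unfolding cuut_word_def cuut_pair_eq_sum
  by (rule Sum_any_basis_sum[of "{0..length x}" "{1..length x}"
        "\<lambda>i. (take i x, drop i x)" "\<lambda>i. (take i x, drop (i - 1) x)" k]) simp_all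

lemma continuous_linear_cuut_word:
  "continuous_linear F \<Longrightarrow> F (cuut_word x) c = cuut_pair (\<lambda>p q. F (basis (p, q)) c) x"
  by (simp add: continuous_linear_Sum_any[of F "cuut_word x"] Sum_any_cuut_word)

lemma cuut_word_eq_cuut_pair:
  "cuut_word x (p, q) = cuut_pair (\<lambda>p' q'. of_bool (p' = p \<and> q' = q)) x"
proof -
  have "cuut_word x (p, q) = cuut_pair (\<lambda>p' q'. of_bool ((p, q) = (p', q'))) x"
    by (rule trans[OF Sum_any_mult_basis[symmetric] Sum_any_cuut_word])
  moreover have "of_bool ((p, q) = (p', q')) = (of_bool (p' = p \<and> q' = q) :: int)" for p' q'
    by auto
  ultimately show ?thesis by (simp only:)
qed

text \<open>Read with \<open>p\<close> and \<open>q\<close> fixed, this is the product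
  \<open>p * q\<close>. Only two words \<open>z\<close> can occur, which is the finiteness behind
  the continuity of \<open>cuut\<close>.\<close>

lemma cuut_word_apply:
  "cuut_word z (p, q) =
    of_bool (z = p @ q) + of_bool (p \<noteq> [] \<and> q \<noteq> [] \<and> last p = hd q \<and> z = p @ tl q)"
  unfolding cuut_word_eq_cuut_pair
proof (induction z arbitrary: p)
  case Nil
  then show ?case by (cases p; cases q) auto
next
  case (Cons a z)
  show ?case
  proof (cases p)
    case Nil
    then show ?thesis by (auto simp: cuut_pair_zero)
  next
    case p: (Cons b p')
    have "cuut_pair (\<lambda>r s. of_bool (a # r = p \<and> s = q)) z =
      of_bool (a = b) * cuut_pair (\<lambda>r s. of_bool (r = p' \<and> s = q)) z"
      by (cases "a = b") (simp_all add: p cuut_pair_zero)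
    then have "cuut_pair (\<lambda>r s. of_bool (r = p \<and> s = q)) (a # z) =
        of_bool (a = b \<and> p' = [] \<and> q = a # z) +
        of_bool (a = b) * (of_bool (z = p' @ q) +
          of_bool (p' \<noteq> [] \<and> q \<noteq> [] \<and> last p' = hd q \<and> z = p' @ tl q))"
      unfolding cuut_pair.simps Cons.IH by (auto simp: p)
    then show ?thesis
      by (cases p'; cases q) (auto simp: p simp del: cuut_pair.simps)
  qed
qed

section \<open>Identities for the multishuffle coefficients\<close>

text \<open>Bounding letters as well as lengths leaves finitely many pairs even over an infinite
  alphabet, which yields the continuity of \<open>multishuffle\<close>.\<close>

lemma shuffle_coeff_bound:
  "shuffle_coeff z x y \<noteq> 0 \<Longrightarrow> set x \<subseteq> set z \<and> length x \<le> length z \<and> set y \<subseteq> set z \<and> length y \<le> length z"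
proof (induction z arbitrary: x y)
  case (Cons a z)
  have "shuffle_coeff z x y \<noteq> 0 \<or> (\<exists>x'. x = a # x' \<and> shuffle_coeff z x' y \<noteq> 0) \<or>
    (\<exists>y'. y = a # y' \<and> shuffle_coeff z x y' \<noteq> 0)"
    using Cons.prems by (cases x; cases y) (auto split: if_splits)
  then show ?case
    using Cons.IH[of x y] Cons.IH[of "tl x" y] Cons.IH[of x "tl y"] by auto
qed (auto split: if_splits)

lemma finite_shuffle_coeff: "finite {(x, y). shuffle_coeff z x y \<noteq> 0}"
proof (rule finite_subset)
  let ?A = "{x. set x \<subseteq> set z \<and> length x \<le> length z}"
  show "{(x, y). shuffle_coeff z x y \<noteq> 0} \<subseteq> ?A \<times> ?A"
    using shuffle_coeff_bound by blast
  show "finite (?A \<times> ?A)"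
    by (intro finite_cartesian_product finite_lists_length_le) auto
qed

lemma finite_shuffle_coeff_left: "finite {x. shuffle_coeff z x y \<noteq> 0}"
  by (rule finite_subset[OF _ finite_imageI[OF finite_shuffle_coeff[of z], of fst]])
    (auto simp: image_iff)

text \<open>The second summand of \<open>cons_mult\<close> counts \<open>y = z\<close> when
  \<open>hd z = a\<close>, and the correction removes exactly this.\<close>

lemma shuffle_coeff_Nil_left: "shuffle_coeff z [] y = of_bool (y = z)"
proof (induction z arbitrary: y)
  case (Cons a z)
  have "shuffle_coeff (a # z) [] y = cons_mult a (\<lambda>y. of_bool (y = z)) y -
      (if z \<noteq> [] \<and> hd z = a then of_bool (y = z) else 0)"
    by (simp add: Cons.IH)
  then show ?case
    by (cases y; cases z) (auto simp del: shuffle_coeff.simps)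
qed simp

lemma cons_mult_add: "cons_mult a (\<lambda>x. f x + g x) x = cons_mult a f x + cons_mult a g x"
  by (cases x) auto

lemma cons_mult_if: "cons_mult a (\<lambda>x. if P then f x else 0) x = (if P then cons_mult a f x else 0)"
  by (cases x) auto

lemma cons_mult_mult_right: "cons_mult a (\<lambda>x. f x * n) x = cons_mult a f x * n"
  by (cases x) (auto simp: distrib_right)

text \<open>This is \<open>\<Delta>(p * q) = \<Delta>(p) * \<Delta>(q)\<close>.\<close>

lemma cuut_shuffle_compat:
  "shuffle_coeff (p @ q) x y +
     (if p \<noteq> [] \<and> q \<noteq> [] \<and> last p = hd q then shuffle_coeff (p @ tl q) x y else 0) =
   cuut_pair (\<lambda>x1 x2. cuut_pair (\<lambda>y1 y2. shuffle_coeff p x1 y1 * shuffle_coeff q x2 y2) y) x"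
proof (induction p arbitrary: x y)
  case Nil
  have eq: "of_bool (P \<and> Q) * n = of_bool P * (of_bool Q * (n :: int))" for P Q n
    by simp
  show ?case
    by (simp add: eq cuut_pair_mult cuut_pair_counit_left del: of_bool_conj)
next
  case (Cons a p)
  let ?B = "\<lambda>x y. cuut_pair (\<lambda>x1 x2. cuut_pair (\<lambda>y1 y2.
    shuffle_coeff p x1 y1 * shuffle_coeff q x2 y2) y) x"
  have if_mult: "(if P then n else 0) * k = (if P then n * k else 0)" for P and n k :: int
    by simp
  have if_pair: "cuut_pair (\<lambda>p q. if P then h p q else 0) x = (if P then cuut_pair h x else 0)"
    for P and h :: "'a list \<Rightarrow> 'a list \<Rightarrow> int" and x
    by (simp add: cuut_pair_zero)
  \<comment> \<open>The recursion for \<open>a # p\<close> acts on \<open>x1\<close> or on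
    \<open>y1\<close>. Associativity with a letter carries it through the pairing of the same word,
    linearity through the other pairing.\<close>
  have "cuut_pair (\<lambda>x1 x2. cuut_pair (\<lambda>y1 y2.
      shuffle_coeff (a # p) x1 y1 * shuffle_coeff q x2 y2) y) x =
    cons_mult a (\<lambda>x. ?B x y) x + cons_mult a (?B x) y -
      (if p \<noteq> [] \<and> hd p = a then ?B x y else 0)"
    by (simp add: distrib_right left_diff_distrib cuut_pair_add cuut_pair_diff if_mult if_pair
        cons_mult_mult_right[symmetric] cuut_pair_cons_mult cuut_pair_cons_mult_param
        del: cuut_pair.simps cons_mult.simps)
  also have "\<dots> = shuffle_coeff ((a # p) @ q) x y +
     (if a # p \<noteq> [] \<and> q \<noteq> [] \<and> last (a # p) = hd q
      then shuffle_coeff ((a # p) @ tl q) x y else 0)"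
  proof (cases "p = []")
    case True
    have nil: "cuut_pair (\<lambda>x1 x2. cuut_pair (\<lambda>y1 y2.
        shuffle_coeff [] x1 y1 * shuffle_coeff q x2 y2) y) x = shuffle_coeff q x y" for x y
      using Cons.IH[of x y] unfolding True by simp
    \<comment> \<open>Here \<open>a # tl q = q\<close>, so the overlap summand cancels the
      correction in the recursion for \<open>a # q\<close>.\<close>
    have "shuffle_coeff (a # tl q) x y = shuffle_coeff q x y" if "q \<noteq> [] \<and> hd q = a"
      using that by (cases q) auto
    then show ?thesis
      unfolding True
      by (cases "q \<noteq> [] \<and> hd q = a")
        (auto simp: nil shuffle_coeff.simps(2)[of a q] simp del: shuffle_coeff.simps cons_mult.simps)
  next
    \<comment> \<open>As \<open>p\<close> is nonempty, it has the same last letter as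
      \<open>a # p\<close> and supplies the first letter of \<open>p @ q\<close> and
      \<open>p @ tl q\<close>, so the induction hypothesis combines with the recursion term by
      term.\<close>
    case False
    then show ?thesis
      unfolding Cons.IH[symmetric] by (simp add: cons_mult_add cons_mult_if del: cons_mult.simps)
  qed
  finally show ?case ..
qed

section \<open>Commutativity and associativity of the coefficients\<close>

lemma shuffle_coeff_commute: "shuffle_coeff z x y = shuffle_coeff z y x"
proof (induction z arbitrary: x y)
  case (Cons a z)
  have "cons_mult a (\<lambda>x. shuffle_coeff z x y) x = cons_mult a (\<lambda>x. shuffle_coeff z y x) x" for x y
    by (rule arg_cong[where f = "\<lambda>f. cons_mult a f x"], rule ext, rule Cons.IH)
  then show ?case
    using Cons.IH[of x y] by simp
qed auto

lemma Sum_any_Cons: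
  fixes h :: "'a list \<Rightarrow> int"
  shows "(\<Sum>w. h (a # w)) = (\<Sum>w. if w \<noteq> [] \<and> hd w = a then h w else 0)"
proof -
  have "{w. (if w \<noteq> [] \<and> hd w = a then h w else 0) \<noteq> 0} = (#) a ` {w. h (a # w) \<noteq> 0}"
    by (auto simp: image_iff split: if_splits) (metis list.collapse)
  then show ?thesis
    by (simp add: Sum_any.expand_set sum.reindex)
qed

lemma Sum_any_diff:
  fixes f g :: "'b \<Rightarrow> int"
  assumes "finite {b. f b \<noteq> 0}" "finite {b. g b \<noteq> 0}"
  shows "(\<Sum>b. f b - g b) = (\<Sum>b. f b) - (\<Sum>b. g b)"
proof -
  have "finite {b. f b - g b \<noteq> 0}"
    by (rule finite_subset[OF _ finite_UnI[OF assms]]) auto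
  then have "(\<Sum>b. (f b - g b) + g b) = (\<Sum>b. f b - g b) + (\<Sum>b. g b)"
    by (intro Sum_any.distrib assms)
  then show ?thesis by simp
qed

lemma finite_mult_left:
  fixes g :: "'b \<Rightarrow> int"
  shows "finite {b. g b \<noteq> 0} \<Longrightarrow> finite {b. k b * g b \<noteq> 0}"
  by (rule rev_finite_subset) auto

lemma Sum_any_cons_mult:
  assumes "finite {w. g w \<noteq> 0}"
  shows "(\<Sum>w. cons_mult a (f w) x * g w) = cons_mult a (\<lambda>x. \<Sum>w. f w x * g w) x"
  by (cases x) (simp_all add: distrib_right Sum_any.distrib[OF finite_mult_left finite_mult_left] assms)

text \<open>This is \<open>\<Delta>(a * g) = (a \<otimes> 1 + 1 \<otimes> a) * \<Delta>(g)\<close>.\<close>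

lemma Sum_any_shuffle_coeff_cons_mult:
  assumes g: "finite {w. g w \<noteq> 0}"
  shows "(\<Sum>w. shuffle_coeff w x y * cons_mult a g w) =
    cons_mult a (\<lambda>x. \<Sum>w. shuffle_coeff w x y * g w) x +
    cons_mult a (\<lambda>y. \<Sum>w. shuffle_coeff w x y * g w) y"
proof -
  let ?c = "\<lambda>w. shuffle_coeff w x y"
  let ?r = "\<lambda>w. if w \<noteq> [] \<and> hd w = a then ?c w * g w else 0"
  have g': "finite {w. g (a # w) \<noteq> 0}"
    using finite_vimageI[OF g, of "(#) a"] by (simp add: vimage_def)
  have r: "finite {w. ?r w \<noteq> 0}"
    by (rule finite_subset[OF _ g]) auto
  have "(\<Sum>w. ?c w * cons_mult a g w) =
      (\<Sum>w. if w \<noteq> [] \<and> hd w = a then ?c w * (g (tl w) + g w) else 0)"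
  proof (rule Sum_any.cong)
    show "?c w * cons_mult a g w = (if w \<noteq> [] \<and> hd w = a then ?c w * (g (tl w) + g w) else 0)" for w
      by (cases w) simp_all
  qed
  also have "\<dots> = (\<Sum>w. ?c (a # w) * g w + ?c (a # w) * g (a # w))"
    unfolding Sum_any_Cons[symmetric] by (simp only: list.sel distrib_left)
  also have "\<dots> = (\<Sum>w. ?c (a # w) * g w) + (\<Sum>w. ?c (a # w) * g (a # w))"
    by (intro Sum_any.distrib finite_mult_left g g')
  also have "(\<Sum>w. ?c (a # w) * g (a # w)) = (\<Sum>w. ?r w)"
    by (rule Sum_any_Cons)
  \<comment> \<open>\<open>?r w\<close> is the correction in \<open>?c (a # w)\<close> times
    \<open>g w\<close>, so adding it leaves only the two \<open>cons_mult\<close> terms.\<close>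
  also have "(\<Sum>w. ?c (a # w) * g w) + (\<Sum>w. ?r w) = (\<Sum>w. ?c (a # w) * g w + ?r w)"
    by (intro Sum_any.distrib[symmetric] finite_mult_left g r)
  also have "\<dots> = (\<Sum>w. cons_mult a (\<lambda>x. shuffle_coeff w x y) x * g w +
      cons_mult a (\<lambda>y. shuffle_coeff w x y) y * g w)"
  proof (rule Sum_any.cong)
    show "?c (a # w) * g w + ?r w = cons_mult a (\<lambda>x. shuffle_coeff w x y) x * g w +
      cons_mult a (\<lambda>y. shuffle_coeff w x y) y * g w" for w
      by (simp add: distrib_right left_diff_distrib)
  qed
  also have "\<dots> = (\<Sum>w. cons_mult a (\<lambda>x. shuffle_coeff w x y) x * g w) +
      (\<Sum>w. cons_mult a (\<lambda>y. shuffle_coeff w x y) y * g w)"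
    by (intro Sum_any.distrib finite_mult_left g)
  finally show ?thesis
    by (simp only: Sum_any_cons_mult[OF g])
qed

text \<open>\<open>T z x y u\<close> is the coefficient of \<open>x \<otimes> y \<otimes> u\<close>
  when \<open>\<Delta>\<close> is applied to \<open>z\<close> and then to the first factor. The
  second application turns \<open>a \<otimes> 1\<close> into
  \<open>a \<otimes> 1 \<otimes> 1 + 1 \<otimes> a \<otimes> 1\<close>, so all three factors enter
  alike.\<close>

lemma shuffle_coeff_assoc_Cons:
  fixes a :: 'a
  defines "T \<equiv> \<lambda>z x y u. \<Sum>w. shuffle_coeff w x y * shuffle_coeff z w (u :: 'a list)"
  shows "T (a # z) x y u = cons_mult a (\<lambda>x. T z x y u) x + cons_mult a (\<lambda>y. T z x y u) y +
    cons_mult a (T z x y) u - (if z \<noteq> [] \<and> hd z = a then T z x y u else 0)"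
proof -
  let ?c = "\<lambda>w. shuffle_coeff w x y"
  \<comment> \<open>\<open>Sum_any\<close> is 0 on infinite supports, so it is split only after the
    summands are known to have finite support.\<close>
  have fin: "finite {w. shuffle_coeff z w u \<noteq> 0}" for u
    by (rule finite_shuffle_coeff_left)
  have fin1: "finite {w. cons_mult a (\<lambda>w. shuffle_coeff z w u) w \<noteq> 0}"
  proof (rule finite_subset)
    show "{w. cons_mult a (\<lambda>w. shuffle_coeff z w u) w \<noteq> 0} \<subseteq>
        {w. shuffle_coeff z w u \<noteq> 0} \<union> (#) a ` {w. shuffle_coeff z w u \<noteq> 0}"
    proof
      fix w assume "w \<in> {w. cons_mult a (\<lambda>w. shuffle_coeff z w u) w \<noteq> 0}"
      then show "w \<in> {w. shuffle_coeff z w u \<noteq> 0} \<union> (#) a ` {w. shuffle_coeff z w u \<noteq> 0}"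
        by (cases w) (auto split: if_splits)
    qed
  qed (simp add: fin)
  have fin2: "finite {w. cons_mult a (shuffle_coeff z w) u \<noteq> 0}"
  proof (rule finite_subset)
    show "{w. cons_mult a (shuffle_coeff z w) u \<noteq> 0} \<subseteq>
        {w. shuffle_coeff z w u \<noteq> 0} \<union> {w. shuffle_coeff z w (tl u) \<noteq> 0}"
      by (cases u) (auto split: if_splits)
  qed (simp add: fin)
  have fin3: "finite {w. (if z \<noteq> [] \<and> hd z = a then shuffle_coeff z w u else 0) \<noteq> 0}"
    by (rule finite_subset[OF _ fin[of u]]) auto
  have fin12: "finite {w. cons_mult a (\<lambda>w. shuffle_coeff z w u) w + cons_mult a (shuffle_coeff z w) u \<noteq> 0}"
    by (rule finite_subset[OF _ finite_UnI[OF fin1 fin2]]) auto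
  have "T (a # z) x y u =
      (\<Sum>w. ?c w * (cons_mult a (\<lambda>w. shuffle_coeff z w u) w + cons_mult a (shuffle_coeff z w) u) -
        ?c w * (if z \<noteq> [] \<and> hd z = a then shuffle_coeff z w u else 0))"
    unfolding T_def shuffle_coeff.simps right_diff_distrib ..
  also have "\<dots> = (\<Sum>w. ?c w * (cons_mult a (\<lambda>w. shuffle_coeff z w u) w + cons_mult a (shuffle_coeff z w) u)) -
      (\<Sum>w. ?c w * (if z \<noteq> [] \<and> hd z = a then shuffle_coeff z w u else 0))"
    by (intro Sum_any_diff finite_mult_left fin12 fin3)
  also have "(\<Sum>w. ?c w * (cons_mult a (\<lambda>w. shuffle_coeff z w u) w + cons_mult a (shuffle_coeff z w) u)) =
      (\<Sum>w. ?c w * cons_mult a (\<lambda>w. shuffle_coeff z w u) w) +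
      (\<Sum>w. ?c w * cons_mult a (shuffle_coeff z w) u)"
    unfolding distrib_left by (intro Sum_any.distrib finite_mult_left fin1 fin2)
  also have "(\<Sum>w. ?c w * cons_mult a (\<lambda>w. shuffle_coeff z w u) w) =
      cons_mult a (\<lambda>x. T z x y u) x + cons_mult a (\<lambda>y. T z x y u) y"
    unfolding T_def by (rule Sum_any_shuffle_coeff_cons_mult[OF fin])
  also have "(\<Sum>w. ?c w * cons_mult a (shuffle_coeff z w) u) = cons_mult a (T z x y) u"
    unfolding T_def
    by (cases u) (simp_all add: distrib_left Sum_any.distrib[OF finite_mult_left finite_mult_left] fin)
  also have "(\<Sum>w. ?c w * (if z \<noteq> [] \<and> hd z = a then shuffle_coeff z w u else 0)) =
      (if z \<noteq> [] \<and> hd z = a then T z x y u else 0)"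
    by (simp add: T_def)
  finally show ?thesis .
qed

text \<open>
  The recursion for both sides is symmetric in \<open>x\<close>, \<open>y\<close> and \<open>u\<close>; with commutativity this gives
  associativity.
\<close>

lemma shuffle_coeff_rotate:
  "(\<Sum>w. shuffle_coeff w x y * shuffle_coeff z w u) = (\<Sum>w. shuffle_coeff w y u * shuffle_coeff z w x)"
proof (induction z arbitrary: x y u)
  case Nil
  have "(\<Sum>w. shuffle_coeff w x y * shuffle_coeff [] w u) = of_bool (x = [] \<and> y = [] \<and> u = [])"
    for x y u :: "'a list"
  proof -
    have "(\<Sum>w. shuffle_coeff w x y * shuffle_coeff [] w u) =
        (\<Sum>w. shuffle_coeff w x y * of_bool (u = []) * of_bool ([] = w))"
      by (rule Sum_any.cong) auto
    then show ?thesis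
      unfolding Sum_any_mult_basis by auto
  qed
  then show ?case by auto
next
  case (Cons a z)
  have eq: "(\<lambda>x. \<Sum>w. shuffle_coeff w x y * shuffle_coeff z w u) = (\<lambda>x. \<Sum>w. shuffle_coeff w y u * shuffle_coeff z w x)"
    "(\<lambda>y. \<Sum>w. shuffle_coeff w x y * shuffle_coeff z w u) = (\<lambda>y. \<Sum>w. shuffle_coeff w y u * shuffle_coeff z w x)"
    "(\<lambda>u. \<Sum>w. shuffle_coeff w x y * shuffle_coeff z w u) = (\<lambda>u. \<Sum>w. shuffle_coeff w y u * shuffle_coeff z w x)"
    by (rule ext, rule Cons.IH)+
  show ?case
    unfolding shuffle_coeff_assoc_Cons eq Cons.IH[of x y u] by simp
qed

lemma shuffle_coeff_assoc:
  "(\<Sum>w. shuffle_coeff w x y * shuffle_coeff z w u) = (\<Sum>w. shuffle_coeff w y u * shuffle_coeff z x w)"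
  unfolding shuffle_coeff_commute[of z x] by (rule shuffle_coeff_rotate)

section \<open>The bialgebra\<close>

lemma continuous_linear_multishuffle: "continuous_linear multishuffle"
  unfolding multishuffle_def
proof (rule continuous_linear_extend)
  show "finite {b. (case b of (x, y) \<Rightarrow> multishuffle_words x y) z \<noteq> 0}" for z :: "'a list"
    using finite_shuffle_coeff[of z] by (simp add: case_prod_unfold multishuffle_words_eq)
qed

lemma multishuffle_basis: "multishuffle (basis (x, y)) = (\<lambda>z. shuffle_coeff z x y)"
  by (simp add: multishuffle_def extend_basis multishuffle_words_eq fun_eq_iff)

lemma continuous_linear_cuut: "continuous_linear cuut"
  unfolding cuut_def
proof (rule continuous_linear_extend)
  fix c :: "'a list \<times> 'a list"
  obtain p q where c: "c = (p, q)" by (cases c)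
  have "{z. cuut_word z c \<noteq> 0} \<subseteq> {p @ q, p @ tl q}"
    by (auto simp: c cuut_word_apply)
  then show "finite {z. cuut_word z c \<noteq> 0}"
    by (rule finite_subset) simp
qed

lemma cuut_basis: "cuut (basis x) = cuut_word x"
  by (simp add: cuut_def extend_basis)

lemma continuous_linear_counit: "continuous_linear (\<lambda>f (_ :: unit). word_counit f)"
  unfolding word_counit_def by (rule continuous_linear_comp_right)

lemma word_counit_basis: "word_counit (basis x) = of_bool (x = [])"
  by (auto simp: word_counit_def basis_def)

lemma word_unit_1: "word_unit 1 = basis []"
  by (simp add: word_unit_def)

lemma continuous_linear_word_unit:
  "continuous_linear (\<lambda>n :: unit comb. word_unit (n ()) :: 'a list comb)"
proof -
  have "word_unit (n ()) = extend (\<lambda>_. basis ([] :: 'a list)) n" for n :: "unit comb"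
  proof -
    have "(\<Sum>b. n b * k) = (\<Sum>b\<in>{()}. n b * k)" for k
      by (rule Sum_any.expand_superset) auto
    then show ?thesis by (simp add: word_unit_def extend_def)
  qed
  then show ?thesis
    using continuous_linear_extend[of "\<lambda>_ :: unit. basis ([] :: 'a list)"] by simp
qed

text \<open>Homogeneity is not a separate clause of \<open>continuous_linear\<close>; it is read off
  the sum formula.\<close>

lemma continuous_linear_word_unit_mult:
  assumes "continuous_linear F"
  shows "F (word_unit n) c = n * F (basis []) c"
proof -
  have "F (word_unit n) c = (\<Sum>b. word_unit n b * F (basis b) c)"
    by (rule continuous_linear_Sum_any[OF assms])
  also have "\<dots> = (\<Sum>b. basis [] b * (n * F (basis b) c))"
    by (rule Sum_any.cong) (simp add: word_unit_def)
  finally show ?thesis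
    by (simp only: Sum_any_basis_mult)
qed

lemma multishuffle_tensor_basis_left:
  "multishuffle (tensor (basis x) f) z = (\<Sum>w. f w * shuffle_coeff z x w)"
proof -
  have "continuous_linear (\<lambda>f. multishuffle (tensor (basis x) f))"
    by (rule continuous_linear_compose[OF continuous_linear_tensor_right continuous_linear_multishuffle])
  from continuous_linear_Sum_any[OF this, of f z] show ?thesis
    by (simp add: basis_Pair[symmetric] multishuffle_basis)
qed

lemma multishuffle_tensor_basis_right:
  "multishuffle (tensor f (basis y)) z = (\<Sum>w. f w * shuffle_coeff z w y)"
proof -
  have "continuous_linear (\<lambda>f. multishuffle (tensor f (basis y)))"
    by (rule continuous_linear_compose[OF continuous_linear_tensor_left continuous_linear_multishuffle])
  from continuous_linear_Sum_any[OF this, of f z] show ?thesis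
    by (simp add: basis_Pair[symmetric] multishuffle_basis)
qed

lemma reassoc_basis: "reassoc (basis ((a, b), c)) = basis (a, (b, c))"
  by (simp add: basis_Pair reassoc_tensor)

lemma multishuffle_assoc:
  "multishuffle (tensor_map multishuffle id h) = multishuffle (tensor_map id multishuffle (reassoc h))"
proof (rule continuous_linear_eqI[where F = "\<lambda>h. multishuffle (tensor_map multishuffle id h)"
      and G = "\<lambda>h. multishuffle (tensor_map id multishuffle (reassoc h))"])
  show "continuous_linear (\<lambda>h. multishuffle (tensor_map multishuffle id h))"
    by (intro continuous_linear_compose[OF _ continuous_linear_multishuffle]
        continuous_linear_tensor_map continuous_linear_multishuffle continuous_linear_id)
  show "continuous_linear (\<lambda>h. multishuffle (tensor_map id multishuffle (reassoc h)))"
    by (intro continuous_linear_compose[OF _ continuous_linear_multishuffle]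
        continuous_linear_compose[OF continuous_linear_reassoc]
        continuous_linear_tensor_map continuous_linear_multishuffle continuous_linear_id)
  fix b :: "('a list \<times> 'a list) \<times> 'a list"
  obtain x y u where b: "b = ((x, y), u)" by (cases b) auto
  show "multishuffle (tensor_map multishuffle id (basis b)) =
      multishuffle (tensor_map id multishuffle (reassoc (basis b)))"
    by (rule ext) (simp add: b reassoc_basis tensor_map_basis multishuffle_basis
        multishuffle_tensor_basis_left multishuffle_tensor_basis_right shuffle_coeff_assoc)
qed

lemma multishuffle_unit_left: "multishuffle (tensor (word_unit n) f) = (\<lambda>b. n * f b)"
proof
  fix z
  have "continuous_linear (\<lambda>g. multishuffle (tensor g f))"
    by (rule continuous_linear_compose[OF continuous_linear_tensor_left continuous_linear_multishuffle])
  from continuous_linear_word_unit_mult[OF this, of n z]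
  show "multishuffle (tensor (word_unit n) f) z = n * f z"
    by (simp add: multishuffle_tensor_basis_left shuffle_coeff_Nil_left eq_commute[of _ z]
        Sum_any_mult_basis)
qed

lemma multishuffle_unit_right: "multishuffle (tensor f (word_unit n)) = (\<lambda>b. n * f b)"
proof
  fix z
  have "continuous_linear (\<lambda>g. multishuffle (tensor f g))"
    by (rule continuous_linear_compose[OF continuous_linear_tensor_right continuous_linear_multishuffle])
  from continuous_linear_word_unit_mult[OF this, of n z]
  show "multishuffle (tensor f (word_unit n)) z = n * f z"
    by (simp add: multishuffle_tensor_basis_right shuffle_coeff_commute[of _ _ "[]"]
        shuffle_coeff_Nil_left eq_commute[of _ z] Sum_any_mult_basis)
qed

lemma cuut_coassoc: "reassoc (tensor_map cuut id (cuut f)) = tensor_map id cuut (cuut f)"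
proof (rule continuous_linear_eqI[where F = "\<lambda>f. reassoc (tensor_map cuut id (cuut f))"
      and G = "\<lambda>f. tensor_map id cuut (cuut f)"])
  have l: "continuous_linear (\<lambda>h. reassoc (tensor_map (cuut :: 'a list comb \<Rightarrow> _) id h))"
    by (intro continuous_linear_compose[OF _ continuous_linear_reassoc]
        continuous_linear_tensor_map continuous_linear_cuut continuous_linear_id)
  have r: "continuous_linear (tensor_map id (cuut :: 'a list comb \<Rightarrow> _))"
    by (intro continuous_linear_tensor_map continuous_linear_cuut continuous_linear_id)
  show "continuous_linear (\<lambda>f. reassoc (tensor_map cuut id (cuut (f :: 'a list comb))))"
    by (rule continuous_linear_compose[OF continuous_linear_cuut l])
  show "continuous_linear (\<lambda>f. tensor_map id cuut (cuut (f :: 'a list comb)))"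
    by (rule continuous_linear_compose[OF continuous_linear_cuut r])
  fix x :: "'a list"
  show "reassoc (tensor_map cuut id (cuut (basis x))) = tensor_map id cuut (cuut (basis x))"
  proof (rule ext, clarify)
    fix p q r :: "'a list"
    \<comment> \<open>\<open>?h\<close> extracts the coefficient of
      \<open>p \<otimes> q \<otimes> r\<close>, so both sides become iterated pairings of the same
      functional.\<close>
    let ?h = "\<lambda>p' q' r'. of_bool (p' = p \<and> q' = q \<and> r' = r) :: int"
    have "reassoc (tensor_map cuut id (basis (w, r'))) (p, q, r) = cuut_pair (\<lambda>p' q'. ?h p' q' r') w"
      for w r'
      by (cases "r' = r") (simp_all add: reassoc_def tensor_map_basis tensor_def cuut_basis
          cuut_word_eq_cuut_pair basis_apply cuut_pair_zero)
    moreover have "tensor_map id cuut (basis (p', w)) (p, q, r) = cuut_pair (\<lambda>q' r'. ?h p' q' r') w"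
      for w p'
      by (cases "p' = p") (simp_all add: tensor_map_basis tensor_def cuut_basis
          cuut_word_eq_cuut_pair basis_apply cuut_pair_zero)
    ultimately show "reassoc (tensor_map cuut id (cuut (basis x))) (p, q, r) =
        tensor_map id cuut (cuut (basis x)) (p, q, r)"
      by (simp only: cuut_basis continuous_linear_cuut_word[OF l] continuous_linear_cuut_word[OF r]
          cuut_pair_assoc)
  qed
qed

text \<open>All coefficients are treated at once, because equality of continuous maps is tested on
  whole combinations.\<close>

lemma cuut_counit_left:
  "tensor_map (\<lambda>f (_ :: unit). word_counit f) id (cuut f) = (\<lambda>c. f (snd c))"
proof (rule continuous_linear_eqI[where F = "\<lambda>f. tensor_map (\<lambda>f (_ :: unit). word_counit f) id (cuut f)"
      and G = "\<lambda>f c. f (snd c)"])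
  have t: "continuous_linear (tensor_map (\<lambda>f (_ :: unit). word_counit f) (id :: 'a list comb \<Rightarrow> _))"
    by (intro continuous_linear_tensor_map continuous_linear_counit continuous_linear_id)
  show "continuous_linear (\<lambda>f. tensor_map (\<lambda>f (_ :: unit). word_counit f) id (cuut (f :: 'a list comb)))"
    by (rule continuous_linear_compose[OF continuous_linear_cuut t])
  show "continuous_linear (\<lambda>f (c :: unit \<times> 'a list). f (snd c))"
    by (rule continuous_linear_comp_right)
  show "tensor_map (\<lambda>f (_ :: unit). word_counit f) id (cuut (basis x)) = (\<lambda>c. basis x (snd c))"
    for x :: "'a list"
    by (rule ext) (auto simp: cuut_basis continuous_linear_cuut_word[OF t] tensor_map_basis
        tensor_def word_counit_basis cuut_pair_counit_left basis_apply)
qed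

lemma cuut_counit_right:
  "tensor_map id (\<lambda>f (_ :: unit). word_counit f) (cuut f) = (\<lambda>c. f (fst c))"
proof (rule continuous_linear_eqI[where F = "\<lambda>f. tensor_map id (\<lambda>f (_ :: unit). word_counit f) (cuut f)"
      and G = "\<lambda>f c. f (fst c)"])
  have t: "continuous_linear (tensor_map (id :: 'a list comb \<Rightarrow> _) (\<lambda>f (_ :: unit). word_counit f))"
    by (intro continuous_linear_tensor_map continuous_linear_counit continuous_linear_id)
  show "continuous_linear (\<lambda>f. tensor_map id (\<lambda>f (_ :: unit). word_counit f) (cuut (f :: 'a list comb)))"
    by (rule continuous_linear_compose[OF continuous_linear_cuut t])
  show "continuous_linear (\<lambda>f (c :: 'a list \<times> unit). f (fst c))"
    by (rule continuous_linear_comp_right)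
  show "tensor_map id (\<lambda>f (_ :: unit). word_counit f) (cuut (basis x)) = (\<lambda>c. basis x (fst c))"
    for x :: "'a list"
    by (rule ext) (auto simp: cuut_basis continuous_linear_cuut_word[OF t] tensor_map_basis
        tensor_def word_counit_basis cuut_pair_counit_right basis_apply)
qed

lemma cuut_multishuffle:
  "cuut (multishuffle h) =
   tensor_map multishuffle multishuffle (swap_middle (tensor_map cuut cuut h))"
proof (rule continuous_linear_eqI[where F = "\<lambda>h. cuut (multishuffle h)"
      and G = "\<lambda>h. tensor_map multishuffle multishuffle (swap_middle (tensor_map cuut cuut h))"])
  let ?F = "\<lambda>h :: (('a list \<times> 'a list) \<times> ('a list \<times> 'a list)) comb.
    tensor_map multishuffle multishuffle (swap_middle h)"
  have F: "continuous_linear ?F"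
    by (intro continuous_linear_compose[OF continuous_linear_swap_middle]
        continuous_linear_tensor_map continuous_linear_multishuffle)
  show "continuous_linear (\<lambda>h :: ('a list \<times> 'a list) comb. cuut (multishuffle h))"
    by (rule continuous_linear_compose[OF continuous_linear_multishuffle continuous_linear_cuut])
  show "continuous_linear (\<lambda>h. ?F (tensor_map cuut cuut h))"
    by (intro continuous_linear_compose[OF _ F] continuous_linear_tensor_map continuous_linear_cuut)
  fix b :: "'a list \<times> 'a list"
  obtain x y where b: "b = (x, y)" by (cases b)
  have "cuut (multishuffle (basis b)) (p, q) = ?F (tensor_map cuut cuut (basis b)) (p, q)" for p q
  proof -
    have "cuut (multishuffle (basis b)) (p, q) =
        (\<Sum>z. shuffle_coeff z x y * cuut_word z (p, q))"
      by (simp add: b multishuffle_basis cuut_def extend_def)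
    \<comment> \<open>Only \<open>z = p @ q\<close> and \<open>z = p @ tl q\<close> contribute,
      which leaves the left-hand side of \<open>cuut_shuffle_compat\<close>.\<close>
    also have "\<dots> = shuffle_coeff (p @ q) x y +
        (if p \<noteq> [] \<and> q \<noteq> [] \<and> last p = hd q then shuffle_coeff (p @ tl q) x y else 0)"
    proof -
      let ?o = "of_bool (p \<noteq> [] \<and> q \<noteq> [] \<and> last p = hd q) :: int"
      have "(\<Sum>z. shuffle_coeff z x y * cuut_word z (p, q)) =
          (\<Sum>z. shuffle_coeff z x y * of_bool (p @ q = z) +
            shuffle_coeff z x y * ?o * of_bool (p @ tl q = z))"
        by (rule Sum_any.cong) (auto simp: cuut_word_apply)
      also have "\<dots> = (\<Sum>z. shuffle_coeff z x y * of_bool (p @ q = z)) +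
          (\<Sum>z. shuffle_coeff z x y * ?o * of_bool (p @ tl q = z))"
        by (intro Sum_any.distrib finite_mult_left) simp_all
      finally show ?thesis
        unfolding Sum_any_mult_basis by simp
    qed
    also have "\<dots> = cuut_pair (\<lambda>x1 x2. cuut_pair (\<lambda>y1 y2.
        shuffle_coeff p x1 y1 * shuffle_coeff q x2 y2) y) x"
      by (rule cuut_shuffle_compat)
    \<comment> \<open>The two coproducts are expanded one at a time, by continuity of
      \<open>?F\<close> on tensors in each argument separately.\<close>
    also have "\<dots> = ?F (tensor (cuut_word x) (cuut_word y)) (p, q)"
    proof -
      have "?F (tensor (cuut_word x) (cuut_word y)) (p, q) =
          cuut_pair (\<lambda>x1 x2. ?F (tensor (basis (x1, x2)) (cuut_word y)) (p, q)) x"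
        by (rule continuous_linear_cuut_word[OF continuous_linear_compose[OF
              continuous_linear_tensor_left F]])
      moreover have "?F (tensor (basis c) (cuut_word y)) (p, q) =
          cuut_pair (\<lambda>y1 y2. ?F (tensor (basis c) (basis (y1, y2))) (p, q)) y" for c
        by (rule continuous_linear_cuut_word[OF continuous_linear_compose[OF
              continuous_linear_tensor_right F]])
      moreover have "?F (tensor (basis (x1, x2)) (basis (y1, y2))) (p, q) =
          shuffle_coeff p x1 y1 * shuffle_coeff q x2 y2" for x1 x2 y1 y2
        by (simp only: basis_Pair[symmetric] swap_middle_basis tensor_map_basis multishuffle_basis)
          (simp add: tensor_def)
      ultimately show ?thesis by simp
    qed
    also have "\<dots> = ?F (tensor_map cuut cuut (basis b)) (p, q)"
      by (simp add: b tensor_map_basis cuut_basis)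
    finally show ?thesis .
  qed
  then show "cuut (multishuffle (basis b)) = ?F (tensor_map cuut cuut (basis b))"
    by auto
qed

lemma word_counit_multishuffle:
  "word_counit (multishuffle h) =
   tensor_map (\<lambda>f (_ :: unit). word_counit f) (\<lambda>f (_ :: unit). word_counit f) h ((), ())"
proof -
  let ?E = "\<lambda>f :: 'a list comb. \<lambda>_ :: unit. word_counit f"
  have "(\<lambda>h (_ :: unit). word_counit (multishuffle h)) h = (\<lambda>h (_ :: unit). tensor_map ?E ?E h ((), ())) h"
  proof (rule continuous_linear_eqI[where F = "\<lambda>h (_ :: unit). word_counit (multishuffle h)"
      and G = "\<lambda>h (_ :: unit). tensor_map ?E ?E h ((), ())"])
    show "continuous_linear (\<lambda>(h :: ('a list \<times> 'a list) comb) (_ :: unit). word_counit (multishuffle h))"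
      by (rule continuous_linear_compose[OF continuous_linear_multishuffle continuous_linear_counit])
    show "continuous_linear (\<lambda>h (_ :: unit). tensor_map ?E ?E h ((), ()))"
      by (rule continuous_linear_compose[OF continuous_linear_tensor_map[OF
            continuous_linear_counit continuous_linear_counit] continuous_linear_comp_right])
    \<comment> \<open>The empty word is a multishuffle of two empty words only.\<close>
    show "(\<lambda>_ :: unit. word_counit (multishuffle (basis b))) = (\<lambda>_. tensor_map ?E ?E (basis b) ((), ()))"
      for b :: "'a list \<times> 'a list"
      by (cases b) (simp add: tensor_map_basis tensor_def word_counit_basis multishuffle_basis,
          simp add: word_counit_def)
  qed
  then show ?thesis by (simp add: fun_eq_iff)
qed

theorem theorem3p3:
  shows "complete_bialgebra
           (multishuffle :: ('a::countable list \<times> 'a list \<Rightarrow> int) \<Rightarrow> 'a list \<Rightarrow> int)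
           word_unit cuut word_counit"
proof unfold_locales
  \<comment> \<open>For the empty word the range of the overlapping cuts is empty, which leaves the
    single plain cut.\<close>
  show "cuut (word_unit 1) = tensor (word_unit 1) (word_unit 1 :: 'a list comb)"
    by (simp add: word_unit_1 cuut_basis cuut_word_def basis_Pair)
qed (simp_all add: continuous_linear_multishuffle continuous_linear_word_unit multishuffle_assoc
    multishuffle_unit_left multishuffle_unit_right continuous_linear_cuut continuous_linear_counit
    cuut_coassoc cuut_counit_left cuut_counit_right cuut_multishuffle word_counit_multishuffle
    word_unit_1 word_counit_basis)

end
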